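(* Let $\nu>0$ and consider the semi-discrete viscous Burgers system $$\boldsymbol{M} \begin{pmatrix} \frac{\mathrm{d} \underline{v}(t)}{\mathrm{d}t} \\ \underline{f_r}(t) \\ - y_\ell(t) \\ - y_r(t) \\ - y^\nu_\ell(t) \\ - y^\nu_r(t) \end{pmatrix} = \begin{bmatrix} D & -R & B_\ell & B_r & 0 & 0 \\ R^\top & 0 & 0 & 0 & B^\nu_\ell & B^\nu_r \\ -B_\ell^\top & 0 & 0 & 0 & 0 & 0 \\ -B_r^\top & 0 & 0 & 0 & 0 & 0 \\ 0 & -(B^\nu_\ell)^\top & 0 & 0 & 0 & 0 \\ 0 & -(B^\nu_r)^\top & 0 & 0 & 0 & 0 \end{bmatrix} \begin{pmatrix} \underline{e}(t) \\ \underline{e_r}(t) \\ u_\ell(t) \\ u_r(t) \\ u^\nu_\ell(t) \\ u^\nu_r(t) \end{pmatrix}, \qquad \boldsymbol{M} := \mathrm{Diag}(M, M, 2, 2, 1, 1),$$ together with the weak constitutive relations, for all $i = 1,\dots,N$, $$\int_0^1 e_d \, \varphi^i \, \mathrm{d}x = \int_0^1 \frac{v_d^2}{2} \, \varphi^i \, \mathrm{d}x, \qquad \int_0^1 v_d \, e_{rd} \, \varphi^i \, \mathrm{d}x = \int_0^1 \nu \, f_{rd} \, \varphi^i \, \mathrm{d}x .$$ Then, along the solutions of this system, the discrete Hamiltonian $\mathcal{H}^d(\underline{v}(t)) := \mathcal{H}(v_d(t,\cdot))$ satisfies the discrete power balance $$\frac{\mathrm{d}}{\mathrm{d}t} \mathcal{H}^d(\underline{v}(t))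 = - \frac{1}{\nu} \int_0^1 v_d(t,x) \left( e_{rd}(t,x) \right)^2 \mathrm{d}x + u^\nu_\ell(t)\, y^\nu_\ell(t) + u^\nu_r(t)\, y^\nu_r(t) + u_\ell(t) \, 2 \, y_\ell(t) + u_r(t) \, 2 \, y_r(t) .$$
   Context: The Hamiltonian is $\mathcal{H}(v) := \int_0^1 \frac{v^3(x)}{6}\,\mathrm{d}x$. Let $\Phi = \{\varphi^i\}_{i=0}^{N+1}$, where $\{\varphi^i\}_{i=1}^N$ is a (real) finite element basis for $H^1_0(0,1)$ (linearly independent functions in $H^1_0(0,1)$), and where $\varphi^0 = d_0$, $\varphi^{N+1} = d_1$ are Dirac masses at the boundary points $0$ and $1$, used only to label the boundary degrees of freedom. For coefficient vectors $\underline{v}, \underline{e}, \underline{e_r}, \underline{f_r}$ in $\mathbb{R}^N$ (depending on $t$) with components $v_i, e_i, e_{ri}, f_{ri}$, set $v_d := \sum_{i=1}^N v_i\,\varphi^i$, $e_d := \sum_{i=1}^N e_i\,\varphi^i$, $e_{rd} := \sum_{i=1}^N e_{ri}\,\varphi^i$, $f_{rd} := \sum_{i=1}^N f_{ri}\,\varphi^i$. The matrices are $M, D, R \in \mathcal{M}_N(\mathbb{R})$ with $(M)_{ij} := \int_0^1 \varphi^j \varphi^i \,\mathrm{d}x$, $(D)_{ij} := \int_0^1 \varphi^j\, \partial_x \varphi^i \,\mathrm{d}x$, $(R)_{ij} := \int_0^1 \partial_x\varphi^j\, \varphi^i \,\mathrm{d}x$, and $B_\ell, B_r, B^\nu_\ell,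 B^\nu_r \in \mathbb{R}^N$ with $(B_\ell)_i := \sqrt{2}\,\delta_{0i}$, $(B_r)_i := -\sqrt{2}\,\delta_{(N+1)i}$, $(B^\nu_\ell)_i := -\delta_{0i}$, $(B^\nu_r)_i := \delta_{(N+1)i}$, where $\delta$ is the Kronecker symbol. The scalar functions $u_\ell, u_r, u^\nu_\ell, u^\nu_r$ are boundary controls and $y_\ell, y_r, y^\nu_\ell, y^\nu_r$ boundary observations. $\mathrm{Diag}$ denotes a block-diagonal matrix. *)

theory Defs
  imports "HOL-Analysis.Analysis" "Jordan_Normal_Form.Matrix"
begin

section \<open>The Sobolev space of functions on the unit interval with zero boundary values\<close>

text \<open>Elements of Lebesgue and Sobolev spaces are given by representatives, that is,
  by functions on the reals of which only the values almost everywhere on the open unit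
  interval matter.\<close>

abbreviation unit_interval :: "real measure" where
  "unit_interval \<equiv> lebesgue_on {0<..<1}"

definition L2 :: "(real \<Rightarrow> real) set" where
  "L2 = {f \<in> borel_measurable unit_interval. integrable unit_interval (\<lambda>x. (f x)\<^sup>2)}"

text \<open>A closed subset of the reals contained in the open unit interval is compact, so these
  are the smooth functions with compact support in the open unit interval.\<close>

definition test_functions :: "(real \<Rightarrow> real) set" where
  "test_functions = {\<psi>. (\<forall>k. (deriv ^^ k) \<psi> differentiable_on UNIV) \<and>
                        closure {x. \<psi> x \<noteq> 0} \<subseteq> {0<..<1}}"

definition is_weak_deriv :: "(real \<Rightarrow> real) \<Rightarrow> (real \<Rightarrow> real) \<Rightarrow> bool" where
  "is_weak_deriv f g \<longleftrightarrow>
     (\<forall>\<psi>\<in>test_functions. (\<integral>x. f x * deriv \<psi> x \<partial>unit_interval) = - (\<integral>x. g x * \<psi> x \<partial>unit_interval))"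

definition H1 :: "(real \<Rightarrow> real) set" where
  "H1 = {f \<in> L2. \<exists>g\<in>L2. is_weak_deriv f g}"

text \<open>The weak derivative is unique up to null sets; this picks a representative.\<close>

definition weak_deriv :: "(real \<Rightarrow> real) \<Rightarrow> real \<Rightarrow> real" where
  "weak_deriv f = (SOME g. g \<in> L2 \<and> is_weak_deriv f g)"

text \<open>The closure of the test functions in the norm of \<^term>\<open>H1\<close>.\<close>

definition H10 :: "(real \<Rightarrow> real) set" where
  "H10 = {f \<in> H1. \<exists>\<psi> :: nat \<Rightarrow> real \<Rightarrow> real. (\<forall>n. \<psi> n \<in> test_functions) \<and>
     (\<lambda>n. (\<integral>x. (f x - \<psi> n x)\<^sup>2 \<partial>unit_interval)
         + (\<integral>x. (weak_deriv f x - deriv (\<psi> n) x)\<^sup>2 \<partial>unit_interval)) \<longlonglongrightarrow> 0}"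

section \<open>Finite element discretisation\<close>

text \<open>Basis functions carry the indices 1 to N. As vectors and matrices count their entries
  from 0, entry \<open>i - 1\<close> of a coefficient vector belongs to the basis function with
  index \<open>i\<close>; likewise for matrices.\<close>

definition fe_basis :: "nat \<Rightarrow> (nat \<Rightarrow> real \<Rightarrow> real) \<Rightarrow> bool" where
  "fe_basis N \<phi> \<longleftrightarrow> (\<forall>i\<in>{1..N}. \<phi> i \<in> H10) \<and>
     (\<forall>c. (AE x in unit_interval. (\<Sum>i=1..N. c i * \<phi> i x) = 0) \<longrightarrow> (\<forall>i\<in>{1..N}. c i = 0))"

definition fe_fun :: "nat \<Rightarrow> (nat \<Rightarrow> real \<Rightarrow> real) \<Rightarrow> real Matrix.vec \<Rightarrow> real \<Rightarrow> real" where
  "fe_fun N \<phi> c x = (\<Sum>i=1..N. vec_index c (i - 1) * \<phi> i x)"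

definition hamiltonian :: "(real \<Rightarrow> real) \<Rightarrow> real" where
  "hamiltonian v = (\<integral>x. (v x) ^ 3 / 6 \<partial>unit_interval)"

definition discrete_hamiltonian :: "nat \<Rightarrow> (nat \<Rightarrow> real \<Rightarrow> real) \<Rightarrow> real Matrix.vec \<Rightarrow> real" where
  "discrete_hamiltonian N \<phi> c = hamiltonian (fe_fun N \<phi> c)"

definition mat_M :: "nat \<Rightarrow> (nat \<Rightarrow> real \<Rightarrow> real) \<Rightarrow> real Matrix.mat" where
  "mat_M N \<phi> = Matrix.mat N N (\<lambda>(i, j).
     \<integral>x. \<phi> (j + 1) x * \<phi> (i + 1) x \<partial>unit_interval)"

definition mat_D :: "nat \<Rightarrow> (nat \<Rightarrow> real \<Rightarrow> real) \<Rightarrow> real Matrix.mat" where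
  "mat_D N \<phi> = Matrix.mat N N (\<lambda>(i, j).
     \<integral>x. \<phi> (j + 1) x * weak_deriv (\<phi> (i + 1)) x \<partial>unit_interval)"

definition mat_R :: "nat \<Rightarrow> (nat \<Rightarrow> real \<Rightarrow> real) \<Rightarrow> real Matrix.mat" where
  "mat_R N \<phi> = Matrix.mat N N (\<lambda>(i, j).
     \<integral>x. weak_deriv (\<phi> (j + 1)) x * \<phi> (i + 1) x \<partial>unit_interval)"

definition kronecker :: "nat \<Rightarrow> nat \<Rightarrow> real" where
  "kronecker i j = (if i = j then 1 else 0)"

text \<open>The control vectors are column matrices with N rows. Their rows carry the indices
  1 to N, whereas the boundary degrees of freedom carry the labels 0 and \<open>N + 1\<close>.
  With this indexing, all four vectors are zero.\<close>

definition B_l :: "nat \<Rightarrow> real Matrix.mat" where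
  "B_l N = Matrix.mat N 1 (\<lambda>(i, j). sqrt 2 * kronecker 0 (i + 1))"

definition B_r :: "nat \<Rightarrow> real Matrix.mat" where
  "B_r N = Matrix.mat N 1 (\<lambda>(i, j). - sqrt 2 * kronecker (N + 1) (i + 1))"

definition Bnu_l :: "nat \<Rightarrow> real Matrix.mat" where
  "Bnu_l N = Matrix.mat N 1 (\<lambda>(i, j). - kronecker 0 (i + 1))"

definition Bnu_r :: "nat \<Rightarrow> real Matrix.mat" where
  "Bnu_r N = Matrix.mat N 1 (\<lambda>(i, j). kronecker (N + 1) (i + 1))"

section \<open>The block matrices of the semi-discrete system\<close>

definition append_cols :: "real Matrix.mat \<Rightarrow> real Matrix.mat \<Rightarrow> real Matrix.mat"
    (infixr \<open>@\<^sub>c\<close> 70) where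
  "A @\<^sub>c B = four_block_mat A B (0\<^sub>m 0 (dim_col A)) (0\<^sub>m 0 (dim_col B))"

definition block_M :: "nat \<Rightarrow> (nat \<Rightarrow> real \<Rightarrow> real) \<Rightarrow> real Matrix.mat" where
  "block_M N \<phi> = diag_block_mat
     [mat_M N \<phi>, mat_M N \<phi>, 2 \<cdot>\<^sub>m 1\<^sub>m 1, 2 \<cdot>\<^sub>m 1\<^sub>m 1, 1\<^sub>m 1, 1\<^sub>m 1]"

definition block_J :: "nat \<Rightarrow> (nat \<Rightarrow> real \<Rightarrow> real) \<Rightarrow> real Matrix.mat" where
  "block_J N \<phi> = (let D = mat_D N \<phi>; R = mat_R N \<phi> in
     (D @\<^sub>c (- R) @\<^sub>c B_l N @\<^sub>c B_r N @\<^sub>c 0\<^sub>m N 1 @\<^sub>c 0\<^sub>m N 1) @\<^sub>r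
     (transpose_mat R @\<^sub>c 0\<^sub>m N N @\<^sub>c 0\<^sub>m N 1 @\<^sub>c 0\<^sub>m N 1 @\<^sub>c Bnu_l N @\<^sub>c Bnu_r N) @\<^sub>r
     ((- transpose_mat (B_l N)) @\<^sub>c 0\<^sub>m 1 N @\<^sub>c 0\<^sub>m 1 1 @\<^sub>c 0\<^sub>m 1 1 @\<^sub>c 0\<^sub>m 1 1 @\<^sub>c 0\<^sub>m 1 1) @\<^sub>r
     ((- transpose_mat (B_r N)) @\<^sub>c 0\<^sub>m 1 N @\<^sub>c 0\<^sub>m 1 1 @\<^sub>c 0\<^sub>m 1 1 @\<^sub>c 0\<^sub>m 1 1 @\<^sub>c 0\<^sub>m 1 1) @\<^sub>r
     (0\<^sub>m 1 N @\<^sub>c (- transpose_mat (Bnu_l N)) @\<^sub>c 0\<^sub>m 1 1 @\<^sub>c 0\<^sub>m 1 1 @\<^sub>c 0\<^sub>m 1 1 @\<^sub>c 0\<^sub>m 1 1) @\<^sub>r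
     (0\<^sub>m 1 N @\<^sub>c (- transpose_mat (Bnu_r N)) @\<^sub>c 0\<^sub>m 1 1 @\<^sub>c 0\<^sub>m 1 1 @\<^sub>c 0\<^sub>m 1 1 @\<^sub>c 0\<^sub>m 1 1))"

end

theory Submission
  imports Defs
begin

text \<open>The derivative of the discrete Hamiltonian is \<open>\<integral> v\<^sub>d\<^sup>2 / 2 * \<partial>\<^sub>t v\<^sub>d\<close>. The first
  constitutive relation turns it into \<open>e \<bullet> M v'\<close>, the first block row into
  \<open>e \<bullet> D e - e \<bullet> R e\<^sub>r\<close>, and here \<open>e \<bullet> D e = 0\<close>, since integration by parts without boundary
  terms makes \<open>D\<close> skew-symmetric. By the second block row
  \<open>e \<bullet> R e\<^sub>r = e\<^sub>r \<bullet> M f\<^sub>r\<close>, which the second constitutive relation identifies with the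
  dissipation. The observations vanish, because the control vectors do.
  The Hamiltonian is a cubic polynomial in the coefficients because functions in
  \<^term>\<open>H10\<close> are essentially bounded.\<close>

section \<open>Functions in the Sobolev space with zero boundary values\<close>

lemma finite_measure_unit_interval: "finite_measure unit_interval"
  by (rule finite_measure_lebesgue_on) (use lmeasurable_box[of "0::real" 1] in simp)

lemma L2_borel_measurable: "f \<in> L2 \<Longrightarrow> f \<in> borel_measurable unit_interval"
  by (simp add: L2_def)

text \<open>The product is dominated pointwise by
  \<open>(f x)\<^sup>2 + (g x)\<^sup>2\<close>.\<close>

lemma L2_integrable_mult:
  assumes "f \<in> L2" "g \<in> L2"
  shows "integrable unit_interval (\<lambda>x. f x * g x)"
proof (rule Bochner_Integration.integrable_bound)
  show "integrable unit_interval (\<lambda>x. (f x)\<^sup>2 + (g x)\<^sup>2)"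
    using assms by (auto simp: L2_def)
  show "(\<lambda>x. f x * g x) \<in> borel_measurable unit_interval"
    using assms by (auto simp: L2_def)
  have "\<bar>a * b\<bar> \<le> a\<^sup>2 + b\<^sup>2" for a b :: real
    using sum_squares_bound[of "\<bar>a\<bar>" "\<bar>b\<bar>"] mult_nonneg_nonneg[of "\<bar>a\<bar>" "\<bar>b\<bar>"]
    unfolding abs_mult power2_abs by linarith
  then show "AE x in unit_interval. norm (f x * g x) \<le> norm ((f x)\<^sup>2 + (g x)\<^sup>2)"
    by simp
qed

lemma L2_integrable_power2: "f \<in> L2 \<Longrightarrow> integrable unit_interval (\<lambda>x. (f x)\<^sup>2)"
  by (simp add: L2_def)

lemma L2_diff:
  assumes "f \<in> L2" "g \<in> L2"
  shows "(\<lambda>x. f x - g x) \<in> L2"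
proof -
  have "integrable unit_interval (\<lambda>x. (f x)\<^sup>2 + (g x)\<^sup>2 - 2 * (f x * g x))"
    by (intro Bochner_Integration.integrable_diff Bochner_Integration.integrable_add
        integrable_mult_right L2_integrable_power2 L2_integrable_mult assms)
  also have "(\<lambda>x. (f x)\<^sup>2 + (g x)\<^sup>2 - 2 * (f x * g x)) = (\<lambda>x. (f x - g x)\<^sup>2)"
    by (simp add: power2_diff mult.assoc)
  finally have "integrable unit_interval (\<lambda>x. (f x - g x)\<^sup>2)" .
  moreover have "(\<lambda>x. f x - g x) \<in> borel_measurable unit_interval"
    by (intro borel_measurable_diff L2_borel_measurable assms)
  ultimately show ?thesis
    by (simp add: L2_def)
qed

text \<open>The integral of \<open>(f x - s * g x)\<^sup>2\<close> is a nonnegative polynomial of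
  degree at most two in \<open>s\<close>; a suitable choice of \<open>s\<close> gives the
  inequality.\<close>

lemma L2_Cauchy_Schwarz:
  assumes "f \<in> L2" "g \<in> L2"
  shows "(\<integral>x. f x * g x \<partial>unit_interval)\<^sup>2
    \<le> (\<integral>x. (f x)\<^sup>2 \<partial>unit_interval) * (\<integral>x. (g x)\<^sup>2 \<partial>unit_interval)"
proof -
  define A where "A = (\<integral>x. (f x)\<^sup>2 \<partial>unit_interval)"
  define B where "B = (\<integral>x. f x * g x \<partial>unit_interval)"
  define C where "C = (\<integral>x. (g x)\<^sup>2 \<partial>unit_interval)"
  have quad: "0 \<le> A - 2 * s * B + s\<^sup>2 * C" for s
  proof -
    have "0 \<le> (\<integral>x. (f x - s * g x)\<^sup>2 \<partial>unit_interval)"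
      by (rule Bochner_Integration.integral_nonneg) simp
    also have "\<dots> = (\<integral>x. (f x)\<^sup>2 - 2 * s * (f x * g x) + s\<^sup>2 * (g x)\<^sup>2 \<partial>unit_interval)"
      by (simp add: power2_diff power_mult_distrib algebra_simps)
    also have "\<dots> = A - 2 * s * B + s\<^sup>2 * C"
      using L2_integrable_mult[OF assms] assms[THEN L2_integrable_power2]
      by (simp add: A_def B_def C_def)
    finally show ?thesis .
  qed
  have "0 \<le> C"
    unfolding C_def by (rule Bochner_Integration.integral_nonneg) simp
  have "B\<^sup>2 \<le> A * C"
  proof (cases "C = 0")
    case True
    have "B = 0"
    proof (rule ccontr)
      assume "B \<noteq> 0"
      \<comment> \<open>With \<open>C = 0\<close> the polynomial is affine, and at this
        \<open>s\<close> its value is \<open>- 1\<close>.\<close>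
      then show False
        using quad[of "(A + 1) / (2 * B)"] True by simp
    qed
    then show ?thesis
      using True by simp
  next
    case False
    then have "0 < C"
      using \<open>0 \<le> C\<close> by simp
    \<comment> \<open>\<open>B / C\<close> is the minimiser of the quadratic, with value
      \<open>A - B\<^sup>2 / C\<close>.\<close>
    then show ?thesis
      using quad[of "B / C"] by (simp add: field_simps power2_eq_square)
  qed
  then show ?thesis
    by (simp add: A_def B_def C_def)
qed

text \<open>Strong convergence implies weak convergence: by Cauchy-Schwarz the squared error
  \<open>(d n)\<^sup>2\<close> is at most a constant times the squared \<open>L2\<close> distance of
  \<open>p n\<close> to \<open>f\<close>.\<close>

lemma L2_tendsto_integral_mult:
  assumes f: "f \<in> L2" and h: "h \<in> L2" and p: "\<And>n. p n \<in> L2"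
    and lim: "(\<lambda>n. \<integral>x. (f x - p n x)\<^sup>2 \<partial>unit_interval) \<longlonglongrightarrow> 0"
  shows "(\<lambda>n. \<integral>x. h x * p n x \<partial>unit_interval) \<longlonglongrightarrow> (\<integral>x. h x * f x \<partial>unit_interval)"
proof -
  define d where "d n = (\<integral>x. h x * (f x - p n x) \<partial>unit_interval)" for n
  have d: "d n = (\<integral>x. h x * f x \<partial>unit_interval) - (\<integral>x. h x * p n x \<partial>unit_interval)" for n
    unfolding d_def right_diff_distrib
    by (rule Bochner_Integration.integral_diff) (intro L2_integrable_mult f h p)+
  have "(\<lambda>n. (d n)\<^sup>2) \<longlonglongrightarrow> 0"
  proof (rule tendsto_sandwich[OF _ _ tendsto_const])
    show "\<forall>\<^sub>F n in sequentially. (d n)\<^sup>2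
        \<le> (\<integral>x. (h x)\<^sup>2 \<partial>unit_interval) * (\<integral>x. (f x - p n x)\<^sup>2 \<partial>unit_interval)"
      unfolding d_def
      by (rule always_eventually) (use L2_Cauchy_Schwarz[OF h L2_diff[OF f p]] in blast)
    show "(\<lambda>n. (\<integral>x. (h x)\<^sup>2 \<partial>unit_interval) * (\<integral>x. (f x - p n x)\<^sup>2 \<partial>unit_interval)) \<longlonglongrightarrow> 0"
      by (rule tendsto_mult_right_zero[OF lim])
  qed simp
  then have "d \<longlonglongrightarrow> 0"
    by simp
  from tendsto_diff[OF tendsto_const[of "\<integral>x. h x * f x \<partial>unit_interval"] this]
  show ?thesis
    by (simp add: d)
qed

section \<open>Test functions and a bound by their derivatives\<close>

lemma test_function_DERIV:
  assumes "\<psi> \<in> test_functions"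
  shows "DERIV \<psi> x :> deriv \<psi> x"
proof -
  have "(deriv ^^ 0) \<psi> differentiable_on UNIV"
    using assms unfolding test_functions_def by blast
  then show ?thesis
    by (simp add: differentiable_on_def DERIV_deriv_iff_real_differentiable)
qed

lemma test_function_continuous_deriv:
  assumes "\<psi> \<in> test_functions"
  shows "continuous_on S (deriv \<psi>)"
proof -
  have "(deriv ^^ 1) \<psi> differentiable_on UNIV"
    using assms unfolding test_functions_def by blast
  then have "continuous_on UNIV (deriv \<psi>)"
    by (simp add: differentiable_imp_continuous_on)
  then show ?thesis
    by (rule continuous_on_subset) simp
qed

lemma test_function_continuous:
  assumes "\<psi> \<in> test_functions"
  shows "continuous_on S \<psi>"
proof (rule DERIV_continuous_on)
  show "(\<psi> has_field_derivative deriv \<psi> x) (at x within S)" for x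
    by (rule has_field_derivative_at_within[OF test_function_DERIV[OF assms]])
qed

lemma test_function_zero:
  assumes "\<psi> \<in> test_functions" "x \<notin> {0<..<1}"
  shows "\<psi> x = 0"
  using assms closure_subset[of "{x. \<psi> x \<noteq> 0}"] by (auto simp: test_functions_def)

text \<open>Compactness of the closed interval bounds \<open>f\<close>, and a bounded measurable
  function on a finite measure space is square-integrable.\<close>

lemma continuous_L2:
  assumes "continuous_on {0..1} f"
  shows "f \<in> L2"
proof -
  interpret finite_measure unit_interval
    by (rule finite_measure_unit_interval)
  have meas: "f \<in> borel_measurable unit_interval"
    by (rule continuous_imp_measurable_on_sets_lebesgue)
      (auto intro: continuous_on_subset[OF assms])
  have "bounded (f ` {0..1})"
    using assms by (intro compact_imp_bounded compact_continuous_image) auto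
  then obtain B where B: "\<And>x. x \<in> {0..1} \<Longrightarrow> \<bar>f x\<bar> \<le> B"
    unfolding bounded_iff real_norm_def by blast
  have "integrable unit_interval (\<lambda>x. (f x)\<^sup>2)"
  proof (rule integrable_const_bound[where B = "B\<^sup>2"])
    have "(f x)\<^sup>2 \<le> B\<^sup>2" if "x \<in> {0..1}" for x
      using B[OF that] by (simp add: abs_le_square_iff[symmetric])
    then show "AE x in unit_interval. norm ((f x)\<^sup>2) \<le> B\<^sup>2"
      by (intro AE_I2) (auto simp: space_restrict_space)
  qed (use meas in simp)
  with meas show ?thesis
    by (simp add: L2_def)
qed

text \<open>A one-dimensional Sobolev inequality: \<open>\<psi>\<close> is the integral of its
  derivative from 0, where it vanishes. The elementary estimate of
  \<open>\<bar>deriv \<psi> y\<bar>\<close> by \<open>1 + (deriv \<psi> y)\<^sup>2\<close> brings in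
  the square integral directly.\<close>

lemma test_function_bound:
  assumes "\<psi> \<in> test_functions"
  shows "\<bar>\<psi> x\<bar> \<le> 1 + (\<integral>x. (deriv \<psi> x)\<^sup>2 \<partial>unit_interval)"
proof -
  let ?g = "\<lambda>x. 1 + (deriv \<psi> x)\<^sup>2"
  have nonneg: "0 \<le> (\<integral>x. (deriv \<psi> x)\<^sup>2 \<partial>unit_interval)"
    by (rule Bochner_Integration.integral_nonneg) simp
  have cont: "continuous_on S ?g" for S
    by (intro continuous_intros test_function_continuous_deriv assms)
  show ?thesis
  proof (cases "x \<in> {0<..<1}")
    case True
    have "(deriv \<psi> has_integral \<psi> x - \<psi> 0) {0..x}"
      using True test_function_DERIV[OF assms]
      by (intro fundamental_theorem_of_calculus)
        (auto simp: has_real_derivative_iff_has_vector_derivative[symmetric]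
          intro: has_field_derivative_at_within)
    then have "(deriv \<psi> has_integral \<psi> x) {0..x}"
      using test_function_zero[OF assms, of 0] by simp
    then have "\<bar>\<psi> x\<bar> = norm (integral {0..x} (deriv \<psi>))"
      by (simp add: integral_unique)
    also have "\<dots> \<le> integral {0..x} ?g"
    proof (rule integral_norm_bound_integral)
      show "norm (deriv \<psi> y) \<le> ?g y" for y
        using sum_squares_bound[of 1 "\<bar>deriv \<psi> y\<bar>"] by simp
    qed (intro integrable_continuous_interval cont test_function_continuous_deriv assms)+
    also have "\<dots> \<le> integral {0..1} ?g"
      using True by (intro integral_subset_le integrable_continuous_interval cont) auto
    also have "\<dots> = 1 + integral {0<..<1} (\<lambda>x. (deriv \<psi> x)\<^sup>2)"
      by (subst integral_add)
        (auto simp: integral_open_interval_real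
          intro!: integrable_continuous_interval continuous_intros test_function_continuous_deriv assms)
    \<comment> \<open>Up to here \<open>integral\<close> is the gauge integral; this passes to the
      Lebesgue integral over the open interval.\<close>
    also have "integral {0<..<1} (\<lambda>x. (deriv \<psi> x)\<^sup>2) = (\<integral>x. (deriv \<psi> x)\<^sup>2 \<partial>unit_interval)"
      by (rule lebesgue_integral_eq_integral[symmetric])
        (auto intro: L2_integrable_power2 continuous_L2 test_function_continuous_deriv assms)
    finally show ?thesis .
  next
    case False
    then show ?thesis
      using test_function_zero[OF assms False] nonneg by simp
  qed
qed

section \<open>Weak derivatives and integration by parts\<close>

text \<open>Membership in \<open>H1\<close> supplies the witness that makes the choice in
  \<open>weak_deriv\<close> meaningful.\<close>

lemma H1_weak_deriv:
  assumes "f \<in> H1"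
  shows "weak_deriv f \<in> L2" "is_weak_deriv f (weak_deriv f)"
proof -
  have "weak_deriv f \<in> L2 \<and> is_weak_deriv f (weak_deriv f)"
    unfolding weak_deriv_def
    by (rule someI_ex[of "\<lambda>g. g \<in> L2 \<and> is_weak_deriv f g"]) (use assms in \<open>auto simp: H1_def\<close>)
  then show "weak_deriv f \<in> L2" "is_weak_deriv f (weak_deriv f)"
    by auto
qed

lemma H10_H1: "f \<in> H10 \<Longrightarrow> f \<in> H1"
  by (simp add: H10_def)

lemma H1_L2: "f \<in> H1 \<Longrightarrow> f \<in> L2"
  by (simp add: H1_def)

text \<open>The two error terms are nonnegative, so each is squeezed between 0 and their
  sum.\<close>

lemma H10_approximation:
  assumes "f \<in> H10"
  obtains \<psi> where "\<And>n. \<psi> n \<in> test_functions"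
    and "(\<lambda>n. \<integral>x. (f x - \<psi> n x)\<^sup>2 \<partial>unit_interval) \<longlonglongrightarrow> 0"
    and "(\<lambda>n. \<integral>x. (weak_deriv f x - deriv (\<psi> n) x)\<^sup>2 \<partial>unit_interval) \<longlonglongrightarrow> 0"
proof -
  obtain \<psi> where \<psi>: "\<And>n. \<psi> n \<in> test_functions"
    and lim: "(\<lambda>n. (\<integral>x. (f x - \<psi> n x)\<^sup>2 \<partial>unit_interval)
      + (\<integral>x. (weak_deriv f x - deriv (\<psi> n) x)\<^sup>2 \<partial>unit_interval)) \<longlonglongrightarrow> 0"
    using assms by (auto simp: H10_def)
  have nonneg: "0 \<le> (\<integral>x. (h x)\<^sup>2 \<partial>unit_interval)" for h :: "real \<Rightarrow> real"
    by (rule Bochner_Integration.integral_nonneg) simp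
  show ?thesis
  proof (rule that[OF \<psi>])
    show "(\<lambda>n. \<integral>x. (f x - \<psi> n x)\<^sup>2 \<partial>unit_interval) \<longlonglongrightarrow> 0"
      by (rule tendsto_sandwich[OF _ _ tendsto_const lim])
        (use nonneg in \<open>auto intro!: always_eventually\<close>)
    show "(\<lambda>n. \<integral>x. (weak_deriv f x - deriv (\<psi> n) x)\<^sup>2 \<partial>unit_interval) \<longlonglongrightarrow> 0"
      by (rule tendsto_sandwich[OF _ _ tendsto_const lim])
        (use nonneg in \<open>auto intro!: always_eventually\<close>)
  qed
qed

lemma test_function_L2:
  assumes "\<psi> \<in> test_functions"
  shows "\<psi> \<in> L2" "deriv \<psi> \<in> L2"
  by (intro continuous_L2 test_function_continuous test_function_continuous_deriv assms)+

text \<open>With a test function in place of \<open>f\<close> the identity is the definition of the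
  weak derivative of \<open>g\<close>. Both sides pass to the limit, since the approximants of
  \<open>f\<close> and their derivatives converge in \<open>L2\<close>.\<close>

lemma H10_integration_by_parts:
  assumes f: "f \<in> H10" and g: "g \<in> H1"
  shows "(\<integral>x. g x * weak_deriv f x \<partial>unit_interval) = - (\<integral>x. weak_deriv g x * f x \<partial>unit_interval)"
proof -
  obtain \<psi> where \<psi>: "\<And>n. \<psi> n \<in> test_functions"
    and lim: "(\<lambda>n. \<integral>x. (f x - \<psi> n x)\<^sup>2 \<partial>unit_interval) \<longlonglongrightarrow> 0"
    and lim': "(\<lambda>n. \<integral>x. (weak_deriv f x - deriv (\<psi> n) x)\<^sup>2 \<partial>unit_interval) \<longlonglongrightarrow> 0"
    using H10_approximation[OF f] by blast
  have "(\<lambda>n. \<integral>x. g x * deriv (\<psi> n) x \<partial>unit_interval)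
      \<longlonglongrightarrow> (\<integral>x. g x * weak_deriv f x \<partial>unit_interval)"
    by (intro L2_tendsto_integral_mult H1_L2 H1_weak_deriv H10_H1 f g test_function_L2 \<psi> lim')
  moreover have "(\<integral>x. g x * deriv (\<psi> n) x \<partial>unit_interval)
      = - (\<integral>x. weak_deriv g x * \<psi> n x \<partial>unit_interval)" for n
    using H1_weak_deriv(2)[OF g] \<psi> by (auto simp: is_weak_deriv_def)
  moreover have "(\<lambda>n. - (\<integral>x. weak_deriv g x * \<psi> n x \<partial>unit_interval))
      \<longlonglongrightarrow> - (\<integral>x. weak_deriv g x * f x \<partial>unit_interval)"
    by (intro tendsto_minus L2_tendsto_integral_mult H1_L2 H1_weak_deriv H10_H1 f g
        test_function_L2 \<psi> lim)
  ultimately show ?thesis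
    using LIMSEQ_unique by auto
qed

section \<open>Essentially bounded functions\<close>

text \<open>On the finite measure space these functions form an algebra of integrable functions.
  Square-integrability covers products of two factors, whereas the Hamiltonian and the dissipation
  involve three.\<close>

definition Linf :: "(real \<Rightarrow> real) set" where
  "Linf = {f \<in> borel_measurable unit_interval. \<exists>C. AE x in unit_interval. \<bar>f x\<bar> \<le> C}"

text \<open>Convergence of the derivatives in \<open>L2\<close> bounds their norms, so the
  approximating test functions share one bound \<open>C\<close>, which \<open>f\<close> inherits
  almost everywhere.\<close>

lemma H10_Linf:
  assumes f: "f \<in> H10"
  shows "f \<in> Linf"
proof -
  obtain \<psi> where \<psi>: "\<And>n. \<psi> n \<in> test_functions"
    and lim: "(\<lambda>n. \<integral>x. (f x - \<psi> n x)\<^sup>2 \<partial>unit_interval) \<longlonglongrightarrow> 0"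
    and lim': "(\<lambda>n. \<integral>x. (weak_deriv f x - deriv (\<psi> n) x)\<^sup>2 \<partial>unit_interval) \<longlonglongrightarrow> 0"
    using H10_approximation[OF f] by blast
  have f2: "f \<in> L2" and g2: "weak_deriv f \<in> L2"
    using f by (auto intro: H1_L2 H10_H1 H1_weak_deriv)
  note meas = L2_borel_measurable[OF f2]
  from lim' obtain K
    where K: "\<And>n. \<bar>\<integral>x. (weak_deriv f x - deriv (\<psi> n) x)\<^sup>2 \<partial>unit_interval\<bar> \<le> K"
    using convergent_imp_Bseq[OF convergentI[OF lim']] unfolding Bseq_def real_norm_def by blast
  \<comment> \<open>\<open>C\<close> combines \<open>test_function_bound\<close> with an estimate of
    the square integral of \<open>deriv (\<psi> n)\<close> through \<open>weak_deriv f\<close> and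
    the error bound \<open>K\<close>.\<close>
  define C where "C = 1 + (2 * (\<integral>x. (weak_deriv f x)\<^sup>2 \<partial>unit_interval) + 2 * K)"
  have bound: "\<bar>\<psi> n x\<bar> \<le> C" for n x
  proof -
    note d2 = L2_diff[OF g2 test_function_L2(2)[OF \<psi>[of n]]]
    have "(\<integral>x. (deriv (\<psi> n) x)\<^sup>2 \<partial>unit_interval)
      \<le> (\<integral>x. 2 * (weak_deriv f x)\<^sup>2 + 2 * (weak_deriv f x - deriv (\<psi> n) x)\<^sup>2 \<partial>unit_interval)"
    proof (rule integral_mono)
      \<comment> \<open>The right side exceeds the left by
        \<open>(2 * weak_deriv f x - deriv (\<psi> n) x)\<^sup>2\<close>.\<close>
      show "(deriv (\<psi> n) x)\<^sup>2 \<le> 2 * (weak_deriv f x)\<^sup>2 + 2 * (weak_deriv f x - deriv (\<psi> n) x)\<^sup>2"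
        for x
        using zero_le_power2[of "2 * weak_deriv f x - deriv (\<psi> n) x"]
        by (simp add: power2_eq_square algebra_simps)
    qed (use g2 d2 test_function_L2(2)[OF \<psi>] in \<open>auto simp: L2_integrable_power2\<close>)
    also have "\<dots> = 2 * (\<integral>x. (weak_deriv f x)\<^sup>2 \<partial>unit_interval)
        + 2 * (\<integral>x. (weak_deriv f x - deriv (\<psi> n) x)\<^sup>2 \<partial>unit_interval)"
      using g2 d2 by (simp add: L2_integrable_power2)
    finally show ?thesis
      using test_function_bound[OF \<psi>[of n], of x] K[of n] by (simp add: C_def)
  qed
  txt \<open>The excess of \<open>\<bar>f\<bar>\<close> over the common bound \<open>C\<close> of the approximants is at most the
    distance to each of them, so its square integral vanishes.\<close>
  define h where "h x = max 0 (\<bar>f x\<bar> - C)" for x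
  have h_le: "(h x)\<^sup>2 \<le> (f x - \<psi> n x)\<^sup>2" for n x
    using bound[of n x] unfolding h_def by (auto simp: abs_le_square_iff[symmetric] max_def)
  have meas_h: "h \<in> borel_measurable unit_interval"
    using meas unfolding h_def by simp
  have int_h: "integrable unit_interval (\<lambda>x. (h x)\<^sup>2)"
    using L2_diff[OF f2 test_function_L2(1)[OF \<psi>[of 0]]]
    by (rule Bochner_Integration.integrable_bound[OF L2_integrable_power2])
      (use meas_h h_le[of _ 0] in auto)
  have "(\<integral>x. (h x)\<^sup>2 \<partial>unit_interval) \<le> 0"
  proof (rule LIMSEQ_le_const[OF lim], intro exI allI impI)
    show "(\<integral>x. (h x)\<^sup>2 \<partial>unit_interval) \<le> (\<integral>x. (f x - \<psi> n x)\<^sup>2 \<partial>unit_interval)" for n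
      by (intro integral_mono int_h h_le L2_integrable_power2 L2_diff f2 test_function_L2 \<psi>)
  qed
  moreover have "0 \<le> (\<integral>x. (h x)\<^sup>2 \<partial>unit_interval)"
    by (rule Bochner_Integration.integral_nonneg) simp
  ultimately have "(\<integral>x. (h x)\<^sup>2 \<partial>unit_interval) = 0"
    by simp
  then have "AE x in unit_interval. (h x)\<^sup>2 = 0"
    using integral_nonneg_eq_0_iff_AE[OF int_h] by simp
  then have "AE x in unit_interval. \<bar>f x\<bar> \<le> C"
    by eventually_elim (auto simp: h_def)
  with meas show ?thesis
    by (auto simp: Linf_def)
qed

lemma Linf_integrable:
  assumes "f \<in> Linf"
  shows "integrable unit_interval f"
proof -
  obtain C where "AE x in unit_interval. norm (f x) \<le> C"
    using assms unfolding Linf_def real_norm_def by blast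
  moreover have "f \<in> borel_measurable unit_interval"
    using assms by (simp add: Linf_def)
  ultimately show ?thesis
    by (rule finite_measure.integrable_const_bound[OF finite_measure_unit_interval])
qed

lemma Linf_const: "(\<lambda>x. c) \<in> Linf"
  by (auto simp: Linf_def)

lemma Linf_add:
  assumes "f \<in> Linf" "g \<in> Linf"
  shows "(\<lambda>x. f x + g x) \<in> Linf"
proof -
  obtain A B where A: "AE x in unit_interval. \<bar>f x\<bar> \<le> A" and B: "AE x in unit_interval. \<bar>g x\<bar> \<le> B"
    using assms by (auto simp: Linf_def)
  from A B have "AE x in unit_interval. \<bar>f x + g x\<bar> \<le> A + B"
    by eventually_elim simp
  then show ?thesis
    using assms by (auto simp: Linf_def)
qed

lemma Linf_mult:
  assumes "f \<in> Linf" "g \<in> Linf"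
  shows "(\<lambda>x. f x * g x) \<in> Linf"
proof -
  obtain A B where A: "AE x in unit_interval. \<bar>f x\<bar> \<le> A" and B: "AE x in unit_interval. \<bar>g x\<bar> \<le> B"
    using assms by (auto simp: Linf_def)
  from A B have "AE x in unit_interval. \<bar>f x * g x\<bar> \<le> A * B"
    by eventually_elim (simp add: abs_mult mult_mono')
  then show ?thesis
    using assms by (auto simp: Linf_def)
qed

lemma Linf_sum:
  assumes "\<And>i. i \<in> A \<Longrightarrow> f i \<in> Linf"
  shows "(\<lambda>x. \<Sum>i\<in>A. f i x) \<in> Linf"
  using assms by (induction A rule: infinite_finite_induct) (auto intro: Linf_const Linf_add)

section \<open>Finite element functions\<close>

text \<open>The shift by one makes the summation index the entry position that matrix products
  use.\<close>

lemma fe_fun_eq_sum: "fe_fun N \<phi> c x = (\<Sum>i<N. vec_index c i * \<phi> (i + 1) x)"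
  by (simp add: fe_fun_def sum.atLeast1_atMost_eq)

context
  fixes N :: nat and \<phi> :: "nat \<Rightarrow> real \<Rightarrow> real"
  assumes H10: "\<phi> ` {1..N} \<subseteq> H10"
begin

lemma Linf_basis: "i < N \<Longrightarrow> \<phi> (Suc i) \<in> Linf"
  using H10 by (intro H10_Linf) auto

lemma Linf_fe_fun: "fe_fun N \<phi> c \<in> Linf"
  unfolding fe_fun_eq_sum[abs_def]
  by (intro Linf_sum Linf_mult Linf_const) (simp add: Linf_basis)

text \<open>Boundedness of \<open>h\<close> makes every summand integrable, so linearity applies. An
  identity tested against each basis function thereby extends to all finite element
  functions.\<close>

lemma integral_mult_fe_fun:
  assumes "h \<in> Linf"
  shows "(\<integral>x. h x * fe_fun N \<phi> c x \<partial>unit_interval)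
    = (\<Sum>i<N. vec_index c i * (\<integral>x. h x * \<phi> (i + 1) x \<partial>unit_interval))"
proof -
  have "(\<integral>x. h x * fe_fun N \<phi> c x \<partial>unit_interval)
      = (\<integral>x. (\<Sum>i<N. vec_index c i * (h x * \<phi> (i + 1) x)) \<partial>unit_interval)"
    by (simp add: fe_fun_eq_sum sum_distrib_left mult.left_commute)
  also have "\<dots> = (\<Sum>i<N. \<integral>x. vec_index c i * (h x * \<phi> (i + 1) x) \<partial>unit_interval)"
    by (rule Bochner_Integration.integral_sum)
      (use assms in \<open>auto intro!: Linf_integrable Linf_mult Linf_const Linf_basis\<close>)
  finally show ?thesis
    by simp
qed

text \<open>Expanding one factor at a time separates the coefficients from integrals of basis
  functions, which do not depend on time.\<close>

lemma integral_fe_fun_cubic: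
  "(\<integral>x. fe_fun N \<phi> a x * fe_fun N \<phi> b x * fe_fun N \<phi> c x \<partial>unit_interval)
    = (\<Sum>k<N. \<Sum>j<N. \<Sum>i<N. vec_index a i * vec_index b j * vec_index c k *
        (\<integral>x. \<phi> (k + 1) x * \<phi> (j + 1) x * \<phi> (i + 1) x \<partial>unit_interval))"
proof -
  have "(\<integral>x. fe_fun N \<phi> a x * fe_fun N \<phi> b x * fe_fun N \<phi> c x \<partial>unit_interval)
      = (\<Sum>k<N. vec_index c k *
          (\<integral>x. \<phi> (k + 1) x * fe_fun N \<phi> a x * fe_fun N \<phi> b x \<partial>unit_interval))"
    by (subst integral_mult_fe_fun) (auto intro!: Linf_mult Linf_fe_fun simp: ac_simps)
  also have "\<dots> = (\<Sum>k<N. vec_index c k * (\<Sum>j<N. vec_index b j *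
        (\<integral>x. \<phi> (k + 1) x * \<phi> (j + 1) x * fe_fun N \<phi> a x \<partial>unit_interval)))"
    by (intro sum.cong refl, subst integral_mult_fe_fun)
      (auto intro!: Linf_mult Linf_fe_fun Linf_basis simp: ac_simps)
  also have "\<dots> = (\<Sum>k<N. vec_index c k * (\<Sum>j<N. vec_index b j * (\<Sum>i<N. vec_index a i *
        (\<integral>x. \<phi> (k + 1) x * \<phi> (j + 1) x * \<phi> (i + 1) x \<partial>unit_interval))))"
    by (intro sum.cong refl arg_cong2[where f = "(*)"] integral_mult_fe_fun Linf_mult)
      (auto intro: Linf_basis)
  finally show ?thesis
    by (simp add: sum_distrib_left ac_simps)
qed

section \<open>The time derivative of the discrete Hamiltonian\<close>

text \<open>The Hamiltonian is a finite sum of cubic monomials in the coefficients, so it is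
  differentiated by the product rule and not under the integral sign.\<close>

lemma has_real_derivative_discrete_hamiltonian:
  assumes "\<And>i. i < N \<Longrightarrow>
    ((\<lambda>s. vec_index (v s) i) has_real_derivative vec_index w i) (at t within I)"
  shows "((\<lambda>s. discrete_hamiltonian N \<phi> (v s)) has_real_derivative
    (\<integral>x. (fe_fun N \<phi> (v t) x)\<^sup>2 / 2 * fe_fun N \<phi> w x \<partial>unit_interval)) (at t within I)"
proof -
  define T where
    "T k j i = (\<integral>x. \<phi> (k + 1) x * \<phi> (j + 1) x * \<phi> (i + 1) x \<partial>unit_interval)" for k j i
  define cubic where
    "cubic a b c = (\<integral>x. fe_fun N \<phi> a x * fe_fun N \<phi> b x * fe_fun N \<phi> c x \<partial>unit_interval)" for a b c
  have cubic: "cubic a b c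
      = (\<Sum>k<N. \<Sum>j<N. \<Sum>i<N. vec_index a i * vec_index b j * vec_index c k * T k j i)" for a b c
    unfolding cubic_def T_def by (rule integral_fe_fun_cubic)
  have "((\<lambda>s. cubic (v s) (v s) (v s)) has_real_derivative
      (\<Sum>k<N. \<Sum>j<N. \<Sum>i<N.
        vec_index w i * vec_index (v t) j * vec_index (v t) k * T k j i
        + vec_index (v t) i * vec_index w j * vec_index (v t) k * T k j i
        + vec_index (v t) i * vec_index (v t) j * vec_index w k * T k j i)) (at t within I)"
    unfolding cubic
    by (intro DERIV_sum) (auto intro!: derivative_eq_intros assms simp: algebra_simps)
  then have deriv: "((\<lambda>s. cubic (v s) (v s) (v s)) has_real_derivative
      cubic w (v t) (v t) + cubic (v t) w (v t) + cubic (v t) (v t) w) (at t within I)"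
    by (simp add: cubic sum.distrib)
  \<comment> \<open>Symmetry of the trilinear form merges the three product rule terms into
    \<open>3 * cubic (v t) (v t) w\<close>; division by 6 leaves one half.\<close>
  have sym: "cubic w (v t) (v t) = cubic (v t) (v t) w" "cubic (v t) w (v t) = cubic (v t) (v t) w"
    by (simp_all add: cubic_def ac_simps)
  have "(\<lambda>s. discrete_hamiltonian N \<phi> (v s)) = (\<lambda>s. cubic (v s) (v s) (v s) / 6)"
    by (simp add: discrete_hamiltonian_def hamiltonian_def cubic_def power3_eq_cube)
  moreover have "(\<integral>x. (fe_fun N \<phi> (v t) x)\<^sup>2 / 2 * fe_fun N \<phi> w x \<partial>unit_interval)
      = cubic (v t) (v t) w / 2"
    by (simp add: cubic_def power2_eq_square)
  ultimately show ?thesis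
    using DERIV_cdivide[OF deriv, of 6] sym by simp
qed

section \<open>The forms given by the mass matrix and by \<open>mat_D\<close>\<close>

lemma mat_M_mult_index:
  assumes "c \<in> carrier_vec N" "i < N"
  shows "vec_index (mat_M N \<phi> *\<^sub>v c) i = (\<integral>x. fe_fun N \<phi> c x * \<phi> (i + 1) x \<partial>unit_interval)"
proof -
  have "vec_index (mat_M N \<phi> *\<^sub>v c) i
      = (\<Sum>j<N. vec_index c j * (\<integral>x. \<phi> (i + 1) x * \<phi> (j + 1) x \<partial>unit_interval))"
    using assms by (simp add: mat_M_def scalar_prod_def atLeast0LessThan mult.commute)
  also have "\<dots> = (\<integral>x. \<phi> (i + 1) x * fe_fun N \<phi> c x \<partial>unit_interval)"
    using assms by (subst integral_mult_fe_fun) (auto intro: Linf_basis)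
  finally show ?thesis
    by (simp add: mult.commute)
qed

text \<open>\<open>mat_M\<close> is the Gram matrix of the basis, so its bilinear form is the
  \<open>L2\<close> inner product of finite element functions.\<close>

lemma scalar_prod_mat_M:
  assumes "b \<in> carrier_vec N" "c \<in> carrier_vec N"
  shows "b \<bullet> (mat_M N \<phi> *\<^sub>v c) = (\<integral>x. fe_fun N \<phi> c x * fe_fun N \<phi> b x \<partial>unit_interval)"
proof -
  have "b \<bullet> (mat_M N \<phi> *\<^sub>v c) = (\<Sum>i<N. vec_index b i * vec_index (mat_M N \<phi> *\<^sub>v c) i)"
    by (simp add: scalar_prod_def mat_M_def atLeast0LessThan)
  also have "\<dots> = (\<integral>x. fe_fun N \<phi> c x * fe_fun N \<phi> b x \<partial>unit_interval)"
    using assms by (simp add: mat_M_mult_index integral_mult_fe_fun Linf_fe_fun)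
  finally show ?thesis .
qed

text \<open>Integration by parts makes the entries \<open>d i j\<close> antisymmetric, so exchanging
  the two summation indices turns the quadratic form into its negative.\<close>

lemma scalar_prod_mat_D:
  assumes "c \<in> carrier_vec N"
  shows "c \<bullet> (mat_D N \<phi> *\<^sub>v c) = 0"
proof -
  define d where "d i j = (\<integral>x. \<phi> (j + 1) x * weak_deriv (\<phi> (i + 1)) x \<partial>unit_interval)" for i j
  have skew: "d i j = - d j i" if "i < N" "j < N" for i j
  proof -
    have "\<phi> (i + 1) \<in> H10" "\<phi> (j + 1) \<in> H10"
      using that H10 by auto
    then show ?thesis
      using H10_integration_by_parts[of "\<phi> (i + 1)" "\<phi> (j + 1)"] H10_H1[of "\<phi> (j + 1)"]
      by (simp add: d_def mult.commute)
  qed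
  define S where "S = (\<Sum>i<N. \<Sum>j<N. vec_index c i * (d i j * vec_index c j))"
  have D: "c \<bullet> (mat_D N \<phi> *\<^sub>v c) = S"
    using assms by (simp add: mat_D_def scalar_prod_def atLeast0LessThan sum_distrib_left d_def S_def)
  have "S = (\<Sum>i<N. \<Sum>j<N. vec_index c j * (d j i * vec_index c i))"
    unfolding S_def by (rule sum.swap)
  also have "\<dots> = (\<Sum>i<N. \<Sum>j<N. - (vec_index c i * (d i j * vec_index c j)))"
    by (intro sum.cong refl, subst skew) auto
  also have "\<dots> = - S"
    by (simp add: S_def sum_negf)
  finally have "S = 0"
    by simp
  with D show ?thesis
    by simp
qed

end

section \<open>The block rows of the system\<close>

lemma append_cols_carrier [simp]:
  assumes "A \<in> carrier_mat n a" "B \<in> carrier_mat n b"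
  shows "A @\<^sub>c B \<in> carrier_mat n (a + b)"
  using assms by (auto simp: append_cols_def)

text \<open>\<open>append_cols\<close> is a block matrix whose lower blocks have no rows, so the
  product formula for four blocks leaves an empty lower part.\<close>

lemma append_cols_mult_vec:
  assumes A: "A \<in> carrier_mat n a" and B: "B \<in> carrier_mat n b"
    and x: "x \<in> carrier_vec a" and y: "y \<in> carrier_vec b"
  shows "(A @\<^sub>c B) *\<^sub>v (x @\<^sub>v y) = A *\<^sub>v x + B *\<^sub>v y"
proof -
  have "(A @\<^sub>c B) *\<^sub>v (x @\<^sub>v y)
      = (A *\<^sub>v x + B *\<^sub>v y) @\<^sub>v (0\<^sub>m 0 a *\<^sub>v x + 0\<^sub>m 0 b *\<^sub>v y)"
    using A B unfolding append_cols_def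
    by (subst four_block_mat_mult_vec[OF A B _ _ x y]) auto
  also have "\<dots> = A *\<^sub>v x + B *\<^sub>v y"
    using A B by (intro eq_vecI) auto
  finally show ?thesis .
qed

lemma zero_append_cols: "0\<^sub>m n a @\<^sub>c 0\<^sub>m n b = 0\<^sub>m n (a + b)"
  unfolding append_cols_def by (rule eq_matI) auto

lemma zero_append_rows: "0\<^sub>m a n @\<^sub>r 0\<^sub>m b n = 0\<^sub>m (a + b) n"
  unfolding append_rows_def by (rule eq_matI) auto

text \<open>The rows carry the indices 1 to \<open>N\<close>, which never meet the labels 0 and
  \<open>N + 1\<close>.\<close>

lemma B_zero: "B_l N = 0\<^sub>m N 1" "B_r N = 0\<^sub>m N 1" "Bnu_l N = 0\<^sub>m N 1" "Bnu_r N = 0\<^sub>m N 1"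
  by (rule eq_matI; simp add: B_l_def B_r_def Bnu_l_def Bnu_r_def kronecker_def)+

lemma mat_carrier [simp]:
  "mat_M N \<phi> \<in> carrier_mat N N" "mat_D N \<phi> \<in> carrier_mat N N" "mat_R N \<phi> \<in> carrier_mat N N"
  by (simp_all add: mat_M_def mat_D_def mat_R_def)

text \<open>As the control vectors vanish, adjacent zero blocks merge. Three block rows remain, the
  last of height 4 for the observations.\<close>

lemma block_J_eq:
  "block_J N \<phi> = (mat_D N \<phi> @\<^sub>c (- mat_R N \<phi>) @\<^sub>c 0\<^sub>m N 4) @\<^sub>r
     (transpose_mat (mat_R N \<phi>) @\<^sub>c 0\<^sub>m N (N + 4)) @\<^sub>r 0\<^sub>m 4 (N + (N + 4))"
proof -
  have "- 0\<^sub>m 1 N = (0\<^sub>m 1 N :: real Matrix.mat)"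
    by (rule eq_matI) auto
  \<comment> \<open>Merging four blocks of size 1 produces the dimension in this form.\<close>
  moreover have "1 + (1 + (1 + 1)) = (4 :: nat)"
    by simp
  ultimately show ?thesis
    by (simp only: block_J_def Let_def B_zero zero_transpose_mat zero_append_cols zero_append_rows)
qed

text \<open>The controls \<open>u\<close> meet zero blocks only, so the product is made of
  \<open>mat_D\<close> and \<open>mat_R\<close> alone.\<close>

lemma block_J_mult_vec:
  assumes e: "e \<in> carrier_vec N" and e_r: "e_r \<in> carrier_vec N" and u: "u \<in> carrier_vec 4"
  shows "block_J N \<phi> *\<^sub>v (e @\<^sub>v e_r @\<^sub>v u)
    = (mat_D N \<phi> *\<^sub>v e - mat_R N \<phi> *\<^sub>v e_r) @\<^sub>v (transpose_mat (mat_R N \<phi>) *\<^sub>v e) @\<^sub>v 0\<^sub>v 4"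
proof -
  have eru: "e_r @\<^sub>v u \<in> carrier_vec (N + 4)" and eeru: "e @\<^sub>v e_r @\<^sub>v u \<in> carrier_vec (N + (N + 4))"
    by (intro append_carrier_vec assms)+
  have R: "- mat_R N \<phi> \<in> carrier_mat N N" and RT: "transpose_mat (mat_R N \<phi>) \<in> carrier_mat N N"
    by simp_all
  have R0: "(- mat_R N \<phi>) @\<^sub>c 0\<^sub>m N 4 \<in> carrier_mat N (N + 4)"
    by (rule append_cols_carrier[OF R]) simp
  have row1: "(mat_D N \<phi> @\<^sub>c (- mat_R N \<phi>) @\<^sub>c 0\<^sub>m N 4) \<in> carrier_mat N (N + (N + 4))"
    by (rule append_cols_carrier[OF _ R0]) simp
  have row2: "(transpose_mat (mat_R N \<phi>) @\<^sub>c 0\<^sub>m N (N + 4)) \<in> carrier_mat N (N + (N + 4))"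
    by (rule append_cols_carrier[OF RT]) simp
  have "(mat_D N \<phi> @\<^sub>c (- mat_R N \<phi>) @\<^sub>c 0\<^sub>m N 4) *\<^sub>v (e @\<^sub>v e_r @\<^sub>v u)
      = mat_D N \<phi> *\<^sub>v e + ((- mat_R N \<phi>) *\<^sub>v e_r + 0\<^sub>m N 4 *\<^sub>v u)"
    using append_cols_mult_vec[OF mat_carrier(2) R0 e eru] append_cols_mult_vec[OF R _ e_r u]
    by simp
  also have "\<dots> = mat_D N \<phi> *\<^sub>v e - mat_R N \<phi> *\<^sub>v e_r"
    using assms by (intro eq_vecI) (auto simp: mat_D_def mat_R_def)
  finally have 1: "(mat_D N \<phi> @\<^sub>c (- mat_R N \<phi>) @\<^sub>c 0\<^sub>m N 4) *\<^sub>v (e @\<^sub>v e_r @\<^sub>v u)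
      = mat_D N \<phi> *\<^sub>v e - mat_R N \<phi> *\<^sub>v e_r" .
  have 2: "(transpose_mat (mat_R N \<phi>) @\<^sub>c 0\<^sub>m N (N + 4)) *\<^sub>v (e @\<^sub>v e_r @\<^sub>v u)
      = transpose_mat (mat_R N \<phi>) *\<^sub>v e"
  proof -
    have "0\<^sub>m N (N + 4) *\<^sub>v (e_r @\<^sub>v u) = 0\<^sub>v N"
      using eru by (intro eq_vecI) auto
    then show ?thesis
      using append_cols_mult_vec[OF RT _ e eru, of "0\<^sub>m N (N + 4)"]
      by (simp add: right_zero_vec[OF mult_mat_vec_carrier[OF RT e]])
  qed
  have 3: "0\<^sub>m 4 (N + (N + 4)) *\<^sub>v (e @\<^sub>v e_r @\<^sub>v u) = 0\<^sub>v 4"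
    using eeru by (intro eq_vecI) auto
  show ?thesis
    unfolding block_J_eq
      mat_mult_append[OF row1 carrier_append_rows[OF row2 zero_carrier_mat] eeru]
      mat_mult_append[OF row2 zero_carrier_mat eeru] 1 2 3 ..
qed

lemma boundary_block_mult_vec:
  "diag_block_mat [2 \<cdot>\<^sub>m 1\<^sub>m 1, 2 \<cdot>\<^sub>m 1\<^sub>m 1, 1\<^sub>m 1, 1\<^sub>m 1] *\<^sub>v vec_of_list [a, b, c, d]
    = vec_of_list [2 * a, 2 * b, c, d :: real]"
proof (rule eq_vecI)
  fix i assume "i < dim_vec (vec_of_list [2 * a, 2 * b, c, d])"
  then consider "i = 0" | "i = 1" | "i = 2" | "i = 3"
    by (auto simp: less_Suc_eq numeral_eq_Suc)
  then show "vec_index (diag_block_mat [2 \<cdot>\<^sub>m 1\<^sub>m 1, 2 \<cdot>\<^sub>m 1\<^sub>m 1, 1\<^sub>m 1, 1\<^sub>m 1]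
      *\<^sub>v vec_of_list [a, b, c, d]) i = vec_index (vec_of_list [2 * a, 2 * b, c, d]) i"
    by cases (simp_all add: Let_def scalar_prod_def vec_of_list_index numeral_eq_Suc)
qed (simp add: Let_def)

text \<open>Peeling off the two copies of \<open>mat_M\<close> leaves the diagonal boundary block
  \<open>Q\<close>.\<close>

lemma block_M_mult_vec:
  assumes dv: "dv \<in> carrier_vec N" and f_r: "f_r \<in> carrier_vec N"
  shows "block_M N \<phi> *\<^sub>v (dv @\<^sub>v f_r @\<^sub>v vec_of_list [a, b, c, d])
    = (mat_M N \<phi> *\<^sub>v dv) @\<^sub>v (mat_M N \<phi> *\<^sub>v f_r) @\<^sub>v vec_of_list [2 * a, 2 * b, c, d]"
proof -
  define Q :: "real Matrix.mat" where
    "Q = diag_block_mat [2 \<cdot>\<^sub>m 1\<^sub>m 1, 2 \<cdot>\<^sub>m 1\<^sub>m 1, 1\<^sub>m 1, 1\<^sub>m 1]"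
  define MQ where "MQ = four_block_mat (mat_M N \<phi>) (0\<^sub>m N 4) (0\<^sub>m 4 N) Q"
  have Q: "Q \<in> carrier_mat 4 4"
    by (rule carrier_matI) (simp_all add: Q_def Let_def)
  have MQ: "MQ \<in> carrier_mat (N + 4) (N + 4)"
    unfolding MQ_def by (rule four_block_carrier_mat[OF mat_carrier(1) Q])
  have y: "vec_of_list [a, b, c, d] \<in> carrier_vec 4"
    by (rule carrier_vecI) simp
  \<comment> \<open>Instantiating the recursion equation at \<open>mat_M N \<phi>\<close> keeps the
    boundary part folded as \<open>Q\<close>.\<close>
  have "block_M N \<phi> = four_block_mat (mat_M N \<phi>) (0\<^sub>m N (N + 4)) (0\<^sub>m (N + 4) N) MQ"
    using MQ Q unfolding block_M_def diag_block_mat.simps(2)[of "mat_M N \<phi>"] Q_def[symmetric] Let_def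
    by (simp add: MQ_def mat_M_def)
  then have "block_M N \<phi> *\<^sub>v (dv @\<^sub>v f_r @\<^sub>v vec_of_list [a, b, c, d])
      = (mat_M N \<phi> *\<^sub>v dv) @\<^sub>v (MQ *\<^sub>v (f_r @\<^sub>v vec_of_list [a, b, c, d]))"
    using mult_mat_vec_split[OF mat_carrier(1) MQ dv] f_r y by auto
  also have "MQ *\<^sub>v (f_r @\<^sub>v vec_of_list [a, b, c, d])
      = (mat_M N \<phi> *\<^sub>v f_r) @\<^sub>v (Q *\<^sub>v vec_of_list [a, b, c, d])"
    unfolding MQ_def by (rule mult_mat_vec_split[OF mat_carrier(1) Q f_r y])
  finally show ?thesis
    unfolding Q_def boundary_block_mult_vec .
qed

text \<open>Both sides of the system are stacked vectors with blocks of equal dimensions, hence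
  agree block by block. The observations carry nonzero weights on the left and face zero on the
  right.\<close>

lemma system_rows:
  assumes "dv \<in> carrier_vec N" "f_r \<in> carrier_vec N" "e \<in> carrier_vec N" "e_r \<in> carrier_vec N"
    and "block_M N \<phi> *\<^sub>v (dv @\<^sub>v f_r @\<^sub>v vec_of_list [- y_l, - y_r, - ynu_l, - ynu_r])
      = block_J N \<phi> *\<^sub>v (e @\<^sub>v e_r @\<^sub>v vec_of_list [u_l, u_r, unu_l, unu_r])"
  shows "mat_M N \<phi> *\<^sub>v dv = mat_D N \<phi> *\<^sub>v e - mat_R N \<phi> *\<^sub>v e_r"
    and "mat_M N \<phi> *\<^sub>v f_r = transpose_mat (mat_R N \<phi>) *\<^sub>v e"
    and "y_l = 0" "y_r = 0" "ynu_l = 0" "ynu_r = 0"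
proof -
  have c: "mat_M N \<phi> *\<^sub>v x \<in> carrier_vec N" "transpose_mat (mat_R N \<phi>) *\<^sub>v x \<in> carrier_vec N"
      "mat_D N \<phi> *\<^sub>v x - mat_R N \<phi> *\<^sub>v y \<in> carrier_vec N" for x y
    by (rule carrier_vecI; simp add: mat_M_def mat_D_def mat_R_def)+
  have u: "vec_of_list [u_l, u_r, unu_l, unu_r] \<in> carrier_vec 4"
    by (rule carrier_vecI) simp
  have "(mat_M N \<phi> *\<^sub>v dv) @\<^sub>v (mat_M N \<phi> *\<^sub>v f_r)
      @\<^sub>v vec_of_list [2 * - y_l, 2 * - y_r, - ynu_l, - ynu_r]
    = (mat_D N \<phi> *\<^sub>v e - mat_R N \<phi> *\<^sub>v e_r) @\<^sub>v (transpose_mat (mat_R N \<phi>) *\<^sub>v e) @\<^sub>v 0\<^sub>v 4"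
    using assms(5) unfolding block_M_mult_vec[OF assms(1,2)] block_J_mult_vec[OF assms(3,4) u] .
  then have rest: "(mat_M N \<phi> *\<^sub>v f_r) @\<^sub>v vec_of_list [2 * - y_l, 2 * - y_r, - ynu_l, - ynu_r]
      = (transpose_mat (mat_R N \<phi>) *\<^sub>v e) @\<^sub>v 0\<^sub>v 4"
    and "mat_M N \<phi> *\<^sub>v dv = mat_D N \<phi> *\<^sub>v e - mat_R N \<phi> *\<^sub>v e_r"
    using append_vec_eq[OF c(1) c(3)] by blast+
  then show "mat_M N \<phi> *\<^sub>v dv = mat_D N \<phi> *\<^sub>v e - mat_R N \<phi> *\<^sub>v e_r"
    by simp
  from rest have obs: "vec_of_list [2 * - y_l, 2 * - y_r, - ynu_l, - ynu_r] = 0\<^sub>v 4"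
    and "mat_M N \<phi> *\<^sub>v f_r = transpose_mat (mat_R N \<phi>) *\<^sub>v e"
    using append_vec_eq[OF c(1) c(2)] by blast+
  then show "mat_M N \<phi> *\<^sub>v f_r = transpose_mat (mat_R N \<phi>) *\<^sub>v e"
    by simp
  have "[2 * - y_l, 2 * - y_r, - ynu_l, - ynu_r] ! i = 0" if "i < 4" for i
    using arg_cong[OF obs, of "\<lambda>w. vec_index w i"] that
    unfolding vec_of_list_index by simp
  from this[of 0] this[of 1] this[of 2] this[of 3]
  show "y_l = 0" "y_r = 0" "ynu_l = 0" "ynu_r = 0"
    by simp_all
qed

section \<open>The power balance along a solution\<close>

text \<open>Time derivatives are taken within \<open>I\<close>, so they are one-sided at end points
  belonging to \<open>I\<close>.\<close>

theorem proposition8: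
  fixes \<nu> :: real and N :: nat and \<phi> :: "nat \<Rightarrow> real \<Rightarrow> real" and I :: "real set"
    and v dv e e_r f_r :: "real \<Rightarrow> real Matrix.vec"
    and u_l u_r unu_l unu_r y_l y_r ynu_l ynu_r :: "real \<Rightarrow> real"
  assumes "\<nu> > 0"
    and "fe_basis N \<phi>"
    and "is_interval I" and "interior I \<noteq> {}"
    and "\<And>t. t \<in> I \<Longrightarrow> v t \<in> carrier_vec N"
    and "\<And>t. t \<in> I \<Longrightarrow> dv t \<in> carrier_vec N"
    and "\<And>t. t \<in> I \<Longrightarrow> e t \<in> carrier_vec N"
    and "\<And>t. t \<in> I \<Longrightarrow> e_r t \<in> carrier_vec N"
    and "\<And>t. t \<in> I \<Longrightarrow> f_r t \<in> carrier_vec N"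
    and "\<And>t i. t \<in> I \<Longrightarrow> i < N \<Longrightarrow>
           ((\<lambda>s. vec_index (v s) i) has_real_derivative vec_index (dv t) i) (at t within I)"
    and "\<And>t. t \<in> I \<Longrightarrow>
           block_M N \<phi> *\<^sub>v
             (dv t @\<^sub>v f_r t @\<^sub>v vec_of_list [- y_l t, - y_r t, - ynu_l t, - ynu_r t]) =
           block_J N \<phi> *\<^sub>v
             (e t @\<^sub>v e_r t @\<^sub>v vec_of_list [u_l t, u_r t, unu_l t, unu_r t])"
    and "\<And>t i. t \<in> I \<Longrightarrow> i \<in> {1..N} \<Longrightarrow>
           (\<integral>x. fe_fun N \<phi> (e t) x * \<phi> i x \<partial>unit_interval) =
           (\<integral>x. (fe_fun N \<phi> (v t) x)\<^sup>2 / 2 * \<phi> i x \<partial>unit_interval)"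
    and "\<And>t i. t \<in> I \<Longrightarrow> i \<in> {1..N} \<Longrightarrow>
           (\<integral>x. fe_fun N \<phi> (v t) x * fe_fun N \<phi> (e_r t) x * \<phi> i x \<partial>unit_interval) =
           (\<integral>x. \<nu> * fe_fun N \<phi> (f_r t) x * \<phi> i x \<partial>unit_interval)"
  shows "\<forall>t\<in>I. ((\<lambda>s. discrete_hamiltonian N \<phi> (v s)) has_real_derivative
           - (1 / \<nu>) * (\<integral>x. fe_fun N \<phi> (v t) x * (fe_fun N \<phi> (e_r t) x)\<^sup>2 \<partial>unit_interval)
           + unu_l t * ynu_l t + unu_r t * ynu_r t + u_l t * 2 * y_l t + u_r t * 2 * y_r t)
         (at t within I)"
proof
  fix t assume t: "t \<in> I"
  have H10: "\<phi> ` {1..N} \<subseteq> H10"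
    using \<open>fe_basis N \<phi>\<close> by (auto simp: fe_basis_def)
  note carrier = assms(6-9)[OF t]
  note rows = system_rows[OF carrier(1) carrier(4) carrier(2) carrier(3) assms(11)[OF t]]
  have Linf_v: "fe_fun N \<phi> (v t) \<in> Linf"
    by (rule Linf_fe_fun[OF H10])
  have Linf_square: "(\<lambda>x. (fe_fun N \<phi> (v t) x)\<^sup>2 / 2) \<in> Linf"
    using Linf_mult[OF Linf_mult[OF Linf_v Linf_v] Linf_const[of "1 / 2"]]
    by (simp add: power2_eq_square)
  have skew: "e t \<bullet> (mat_D N \<phi> *\<^sub>v e t) = 0"
    by (rule scalar_prod_mat_D[OF H10 carrier(2)])
  \<comment> \<open>The first constitutive relation extends by linearity from the basis functions to
    the test function with coefficients \<open>dv t\<close>.\<close>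
  have "(\<integral>x. (fe_fun N \<phi> (v t) x)\<^sup>2 / 2 * fe_fun N \<phi> (dv t) x \<partial>unit_interval)
      = (\<integral>x. fe_fun N \<phi> (e t) x * fe_fun N \<phi> (dv t) x \<partial>unit_interval)"
    unfolding integral_mult_fe_fun[OF H10 Linf_square]
      integral_mult_fe_fun[OF H10 Linf_fe_fun[OF H10]]
    by (intro sum.cong refl arg_cong2[where f = "(*)"] assms(12)[OF t, symmetric]) auto
  also have "\<dots> = e t \<bullet> (mat_M N \<phi> *\<^sub>v dv t)"
    by (simp add: scalar_prod_mat_M[OF H10 carrier(2) carrier(1)] mult.commute)
  \<comment> \<open>The first block row is inserted; its \<open>mat_D\<close> part vanishes by
    \<open>skew\<close>.\<close>
  also have "\<dots> = - (e t \<bullet> (mat_R N \<phi> *\<^sub>v e_r t))"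
    unfolding rows(1)
    by (subst scalar_prod_minus_distrib[of _ N])
      (use carrier skew in \<open>auto intro: mat_carrier[THEN mult_mat_vec_carrier]\<close>)
  \<comment> \<open>Transposition moves \<open>mat_R\<close> onto \<open>e t\<close>, where the
    second block row applies.\<close>
  also have "e t \<bullet> (mat_R N \<phi> *\<^sub>v e_r t) = (transpose_mat (mat_R N \<phi>) *\<^sub>v e t) \<bullet> e_r t"
    by (rule transpose_vec_mult_scalar[symmetric]) (use carrier in auto)
  also have "\<dots> = e_r t \<bullet> (mat_M N \<phi> *\<^sub>v f_r t)"
    unfolding rows(2)[symmetric]
    by (rule comm_scalar_prod[of _ N]) (use carrier in \<open>auto intro: mat_carrier[THEN mult_mat_vec_carrier]\<close>)
  \<comment> \<open>The factor \<open>\<nu>\<close> is inserted to match the second constitutive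
    relation.\<close>
  also have "\<dots> = (1 / \<nu>) * (\<integral>x. \<nu> * fe_fun N \<phi> (f_r t) x * fe_fun N \<phi> (e_r t) x \<partial>unit_interval)"
    using \<open>\<nu> > 0\<close> by (simp add: scalar_prod_mat_M[OF H10 carrier(3) carrier(4)] mult.assoc)
  \<comment> \<open>Testing the second relation with the function of coefficients
    \<open>e_r t\<close> produces the square in the dissipation.\<close>
  also have "(\<integral>x. \<nu> * fe_fun N \<phi> (f_r t) x * fe_fun N \<phi> (e_r t) x \<partial>unit_interval)
      = (\<integral>x. fe_fun N \<phi> (v t) x * fe_fun N \<phi> (e_r t) x * fe_fun N \<phi> (e_r t) x \<partial>unit_interval)"
    unfolding integral_mult_fe_fun[OF H10 Linf_mult[OF Linf_const Linf_fe_fun[OF H10]]]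
      integral_mult_fe_fun[OF H10 Linf_mult[OF Linf_fe_fun[OF H10] Linf_fe_fun[OF H10]]]
    by (intro sum.cong refl arg_cong2[where f = "(*)"] assms(13)[OF t, symmetric]) auto
  finally have "(\<integral>x. (fe_fun N \<phi> (v t) x)\<^sup>2 / 2 * fe_fun N \<phi> (dv t) x \<partial>unit_interval)
      = - (1 / \<nu>) * (\<integral>x. fe_fun N \<phi> (v t) x * (fe_fun N \<phi> (e_r t) x)\<^sup>2 \<partial>unit_interval)"
    by (simp add: power2_eq_square mult.assoc)
  \<comment> \<open>The four boundary terms vanish with the observations, by
    \<open>rows(3-6)\<close>.\<close>
  with has_real_derivative_discrete_hamiltonian[OF H10 assms(10)[OF t]]
  show "((\<lambda>s. discrete_hamiltonian N \<phi> (v s)) has_real_derivative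
      - (1 / \<nu>) * (\<integral>x. fe_fun N \<phi> (v t) x * (fe_fun N \<phi> (e_r t) x)\<^sup>2 \<partial>unit_interval)
      + unu_l t * ynu_l t + unu_r t * ynu_r t + u_l t * 2 * y_l t + u_r t * 2 * y_r t)
    (at t within I)"
    using rows(3-6) by simp
qed

end
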